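(* Let $T\subset\mathbb{R}^2$ be a convex polygon with the notation of the context. For each $1\le i\le n$, define $\mathbf{q}_i\in\chi(\mathcal{M}\Lambda^1(T))$ by $$\mathbf{q}_i = c_{i,0}(\mathbf{x}-\mathbf{x}_* )+\sum_{k=1}^n c_{i,k}\,\mathrm{curl}\,\lambda_k,\qquad c_{i,0}=\frac{|e_i|}{2|T|},\qquad c_{i,k}=-\frac1n\sum_{l=1}^{n-1} l\,b_{i,k+l}\quad(1\le k\le n).$$ Then $\mathbf{q}_i\cdot\mathbf{n}_j|_{e_j}\equiv\delta_{ij}$ for all $1\le j\le n$, and the set $\{\mathbf{q}_i,\ 1\le i\le n\}$ forms a basis for $\chi(\mathcal{M}\Lambda^1(T))$.
   Context: $T\subset\mathbb{R}^2$ is a (closed) convex polygon with vertices $\mathbf{v}_1,\dots,\mathbf{v}_n$ ordered counterclockwise; indices are taken modulo $n$. $e_i$ is the edge connecting $\mathbf{v}_i$ and $\mathbf{v}_{i+1}$, and $\mathbf{n}_i$ is the unit outward normal on $e_i$. $\mathbf{x}_*$ is an arbitrary fixed point in the interior of $T$, and $T_i$ is the triangle with base $e_i$ and apex $\mathbf{x}_*$. $|e_i|$ is the length of $e_i$; $|T_i|$, $|T|$ are the areas of $T_i$, $T$. Generalized barycentric coordinates on $T$ are functions $\lambda_1,\dots,\lambda_n$ on $T$ that are non-negative on $T$ and satisfy $L(\mathbf{x})=\sum_{i=1}^n L(\mathbf{v}_i)\lambda_i(\mathbf{x})$ for every linear (affine) function $L$ and all $\mathbf{x}\in T$. Standing assumption: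 $\lambda_i(\mathbf{v}_j)=\delta_{ij}$, each $\lambda_i$ is linear on each edge of $T$, and $\lambda_i\in C^1(T)$ (up to the boundary). For a scalar function $\phi$, $\mathrm{curl}\,\phi=(-\partial_y\phi,\partial_x\phi)^t$. Define $$\chi(\mathcal{M}\Lambda^1(T))=\mathrm{span}\{\mathrm{curl}\,\lambda_i,\ 1\le i\le n\}+\mathrm{span}\{\mathbf{x}-\mathbf{x}_*\}.$$ For $1\le i,l\le n$, $b_{i,l}=\delta_{il}|e_l|-|e_i|\dfrac{|T_l|}{|T|}$, extended to all integer second indices $l$ by periodicity modulo $n$. *)

theory Defs
  imports "HOL-Analysis.Analysis" "HOL-Library.Function_Algebras"
begin

section \<open>Convex polygons\<close>

text \<open>Vertices are numbered from 1 to n. An arbitrary integer index stands for its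
  representative modulo n in that range.\<close>

definition cyc :: "nat \<Rightarrow> int \<Rightarrow> nat"
  where "cyc n l = nat ((l - 1) mod int n) + 1"

abbreviation next_vertex :: "nat \<Rightarrow> (nat \<Rightarrow> real^2) \<Rightarrow> nat \<Rightarrow> real^2"
  where "next_vertex n v i \<equiv> v (cyc n (int i + 1))"

definition edge :: "nat \<Rightarrow> (nat \<Rightarrow> real^2) \<Rightarrow> nat \<Rightarrow> (real^2) set"
  where "edge n v i = closed_segment (v i) (next_vertex n v i)"

definition edge_length :: "nat \<Rightarrow> (nat \<Rightarrow> real^2) \<Rightarrow> nat \<Rightarrow> real"
  where "edge_length n v i = dist (v i) (next_vertex n v i)"

definition cross2 :: "real^2 \<Rightarrow> real^2 \<Rightarrow> real"
  where "cross2 a b = a$1 * b$2 - a$2 * b$1"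

text \<open>The vertices of the polygon are its extreme points. The last conjunct fixes the
  orientation: the polygon lies to the left when one walks along an edge.\<close>

definition ccw_convex_polygon :: "nat \<Rightarrow> (nat \<Rightarrow> real^2) \<Rightarrow> (real^2) set \<Rightarrow> bool"
  where "ccw_convex_polygon n v T \<longleftrightarrow>
    3 \<le> n \<and> polytope T \<and> aff_dim T = 2 \<and>
    inj_on v {1..n} \<and> {x. x extreme_point_of T} = v ` {1..n} \<and>
    (\<forall>i\<in>{1..n}. (edge n v i) edge_of T) \<and>
    (\<forall>i\<in>{1..n}. \<forall>x\<in>T. 0 \<le> cross2 (next_vertex n v i - v i) (x - v i))"

definition outward_unit_normal :: "(real^2) set \<Rightarrow> real^2 \<Rightarrow> real^2 \<Rightarrow> real^2 \<Rightarrow> bool"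
  where "outward_unit_normal T a b \<nu> \<longleftrightarrow>
    norm \<nu> = 1 \<and> \<nu> \<bullet> (b - a) = 0 \<and> (\<forall>x\<in>T. \<nu> \<bullet> (x - a) \<le> 0)"

definition area :: "(real^2) set \<Rightarrow> real"
  where "area S = measure lborel S"

definition sub_triangle :: "nat \<Rightarrow> (nat \<Rightarrow> real^2) \<Rightarrow> real^2 \<Rightarrow> nat \<Rightarrow> (real^2) set"
  where "sub_triangle n v xs i = convex hull {v i, next_vertex n v i, xs}"


section \<open>Generalized barycentric coordinates\<close>

definition affine_function :: "(real^2 \<Rightarrow> real) \<Rightarrow> bool"
  where "affine_function L \<longleftrightarrow> (\<exists>f c. linear f \<and> L = (\<lambda>x. f x + c))"

definition generalized_barycentric ::
    "nat \<Rightarrow> (nat \<Rightarrow> real^2) \<Rightarrow> (real^2) set \<Rightarrow> (nat \<Rightarrow> real^2 \<Rightarrow> real) \<Rightarrow> bool"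
  where "generalized_barycentric n v T lam \<longleftrightarrow>
    (\<forall>i\<in>{1..n}. \<forall>x\<in>T. 0 \<le> lam i x) \<and>
    (\<forall>L. affine_function L \<longrightarrow> (\<forall>x\<in>T. L x = (\<Sum>i=1..n. L (v i) * lam i x)))"

text \<open>Partial derivatives relative to a closed set T. For a convex T with nonempty interior
  the derivative within T is unique at every point of T, boundary points included, and agrees
  with the usual derivative at interior points.\<close>

definition partial_within :: "2 \<Rightarrow> (real^2) set \<Rightarrow> (real^2 \<Rightarrow> real) \<Rightarrow> real^2 \<Rightarrow> real"
  where "partial_within k T f x = frechet_derivative f (at x within T) (axis k 1)"

definition C1_on :: "(real^2) set \<Rightarrow> (real^2 \<Rightarrow> real) \<Rightarrow> bool"
  where "C1_on T f \<longleftrightarrow>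
    f differentiable_on T \<and> (\<forall>k. continuous_on T (partial_within k T f))"


section \<open>The space of vector fields\<close>

text \<open>A vector field on T is represented by the function on the plane that agrees with it
  on T and vanishes outside T, so that equality of representatives is equality on T. Such
  functions form a real vector space under pointwise operations.\<close>

definition field_on :: "(real^2) set \<Rightarrow> (real^2 \<Rightarrow> real^2) \<Rightarrow> real^2 \<Rightarrow> real^2"
  where "field_on T F = (\<lambda>x. if x \<in> T then F x else 0)"

definition field_scale :: "real \<Rightarrow> (real^2 \<Rightarrow> real^2) \<Rightarrow> real^2 \<Rightarrow> real^2"
  where "field_scale c F = (\<lambda>x. c *\<^sub>R F x)"

interpretation fields: vector_space field_scale
  by unfold_locales (auto simp: field_scale_def fun_eq_iff scaleR_add_right scaleR_add_left)

definition curl :: "(real^2) set \<Rightarrow> (real^2 \<Rightarrow> real) \<Rightarrow> real^2 \<Rightarrow> real^2"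
  where "curl T f = field_on T (\<lambda>x. vector [- partial_within 2 T f x, partial_within 1 T f x])"

definition position_field :: "(real^2) set \<Rightarrow> real^2 \<Rightarrow> real^2 \<Rightarrow> real^2"
  where "position_field T xs = field_on T (\<lambda>x. x - xs)"

definition chi :: "nat \<Rightarrow> (real^2) set \<Rightarrow> real^2 \<Rightarrow> (nat \<Rightarrow> real^2 \<Rightarrow> real) \<Rightarrow> (real^2 \<Rightarrow> real^2) set"
  where "chi n T xs lam =
    {F + G | F G. F \<in> fields.span {curl T (lam i) | i. i \<in> {1..n}} \<and>
                  G \<in> fields.span {position_field T xs}}"


section \<open>The fields q\<close>

definition b_coeff ::
    "nat \<Rightarrow> (nat \<Rightarrow> real^2) \<Rightarrow> (real^2) set \<Rightarrow> real^2 \<Rightarrow> nat \<Rightarrow> int \<Rightarrow> real"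
  where "b_coeff n v T xs i l =
    (let m = cyc n l in
      (if i = m then 1 else 0) * edge_length n v m
      - edge_length n v i * (area (sub_triangle n v xs m) / area T))"

definition c_coeff ::
    "nat \<Rightarrow> (nat \<Rightarrow> real^2) \<Rightarrow> (real^2) set \<Rightarrow> real^2 \<Rightarrow> nat \<Rightarrow> nat \<Rightarrow> real"
  where "c_coeff n v T xs i k =
    (if k = 0 then edge_length n v i / (2 * area T)
     else - (1 / real n) * (\<Sum>l=1..n-1. real l * b_coeff n v T xs i (int k + int l)))"

definition q_field ::
    "nat \<Rightarrow> (nat \<Rightarrow> real^2) \<Rightarrow> (real^2) set \<Rightarrow> real^2 \<Rightarrow> (nat \<Rightarrow> real^2 \<Rightarrow> real) \<Rightarrow> nat \<Rightarrow> real^2 \<Rightarrow> real^2"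
  where "q_field n v T xs lam i =
    field_scale (c_coeff n v T xs i 0) (position_field T xs)
    + (\<Sum>k=1..n. field_scale (c_coeff n v T xs i k) (curl T (lam k)))"

end

theory Submission
  imports Defs
begin

text \<open>
  On the edge \<open>e\<^sub>j\<close> the normal component of \<open>curl \<lambda>\<^sub>k\<close> is minus the tangential derivative of
  \<open>\<lambda>\<^sub>k\<close>, that is \<open>(\<delta>\<^sub>k\<^sub>,\<^sub>j - \<delta>\<^sub>k\<^sub>,\<^sub>j\<^sub>+\<^sub>1) / |e\<^sub>j|\<close>, and the normal component of \<open>x - x\<^sub>*\<close> is
  \<open>2 |T\<^sub>j| / |e\<^sub>j|\<close>. Since the areas \<open>|T\<^sub>l|\<close> add up to \<open>|T|\<close>, the \<open>b\<^sub>i\<^sub>,\<^sub>l\<close> sum to 0 over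
  \<open>l\<close>, and summation by parts gives \<open>c\<^sub>i\<^sub>,\<^sub>j - c\<^sub>i\<^sub>,\<^sub>j\<^sub>+\<^sub>1 = b\<^sub>i\<^sub>,\<^sub>j\<close>; this is the duality
  \<open>q\<^sub>i \<bullet> n\<^sub>j = \<delta>\<^sub>i\<^sub>j\<close>, hence independence. The fields \<open>curl \<lambda>\<^sub>k\<close> sum to 0, so the space is
  spanned by \<open>n\<close> fields and the \<open>q\<^sub>i\<close> span it.
\<close>

section \<open>Planar cross products, derivatives along segments, cyclic sign changes\<close>

lemma cross2_diff_left: "cross2 (a - b) c = cross2 a c - cross2 b c"
  by (simp add: cross2_def algebra_simps)

lemma cross2_scaleR_left: "cross2 (r *\<^sub>R a) b = r * cross2 a b"
  by (simp add: cross2_def algebra_simps)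

lemma cross2_sum_left: "cross2 (sum f A) b = (\<Sum>i\<in>A. cross2 (f i) b)"
  by (simp add: cross2_def sum_subtractf sum_distrib_right)

lemma cross2_eq_0_imp_multiple:
  assumes "cross2 a b = 0" "a \<noteq> 0"
  obtains t where "b = t *\<^sub>R a"
proof (cases "a$1 = 0")
  case True
  then have "a$2 \<noteq> 0" using assms(2) by (simp add: vec_eq_iff forall_2)
  then have "b = (b$2 / a$2) *\<^sub>R a"
    using assms(1) True by (auto simp: vec_eq_iff forall_2 cross2_def)
  then show ?thesis using that by blast
next
  case False
  then have "b = (b$1 / a$1) *\<^sub>R a"
    using assms(1) by (auto simp: vec_eq_iff forall_2 cross2_def field_simps)
  then show ?thesis using that by blast
qed

text \<open>Of three distinct points on a line, one lies strictly between the other two and so is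
  not extreme; the cases on \<open>t\<close> say which one.\<close>

lemma extreme_points_not_collinear:
  assumes ext: "p extreme_point_of T" "q extreme_point_of T" "r extreme_point_of T"
    and ne: "p \<noteq> q" "p \<noteq> r" "q \<noteq> r"
  shows "cross2 (q - p) (r - p) \<noteq> 0"
proof
  assume "cross2 (q - p) (r - p) = 0"
  then obtain t where t: "r - p = t *\<^sub>R (q - p)"
    using cross2_eq_0_imp_multiple ne by (metis eq_iff_diff_eq_0)
  then have r: "r = p + t *\<^sub>R (q - p)" by (metis add.commute diff_add_cancel)
  have T: "p \<in> T" "q \<in> T" "r \<in> T" using ext by (auto simp: extreme_point_of_def)
  consider "t < 0" | "t = 0" | "0 < t \<and> t < 1" | "t = 1" | "1 < t" by linarith
  then show False
  proof cases
    case 1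
    \<comment> \<open>Chosen so that \<open>p = (1 - u) *\<^sub>R q + u *\<^sub>R r\<close>.\<close>
    define u where "u = 1 / (1 - t)"
    have u: "0 < u" "u < 1" "u * t = u - 1" using 1 by (auto simp: u_def field_simps)
    have "(1 - u) *\<^sub>R q + u *\<^sub>R r = (1 - u + u * t) *\<^sub>R q + (u - u * t) *\<^sub>R p"
      unfolding r by (simp add: algebra_simps)
    also have "\<dots> = p" unfolding u(3) by simp
    finally have "p \<in> open_segment q r" using u ne by (force simp: in_segment)
    then show False using ext T by (auto simp: extreme_point_of_def)
  next
    case 3
    then have "r \<in> open_segment p q" using ne r by (force simp: in_segment algebra_simps)
    then show False using ext T by (auto simp: extreme_point_of_def)
  next
    case 5
    define u where "u = 1 / t"
    have u: "0 < u" "u < 1" "u * t = 1" using 5 by (auto simp: u_def field_simps)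
    have "(1 - u) *\<^sub>R p + u *\<^sub>R r = p + (u * t) *\<^sub>R (q - p)" unfolding r by (simp add: algebra_simps)
    then have "q \<in> open_segment p r" using u ne by (force simp: in_segment)
    then show False using ext T by (auto simp: extreme_point_of_def)
  qed (use r ne in auto)
qed

text \<open>Composing with the segment gives a function of one variable on \<open>{0..1}\<close>,
  whose one-sided derivative at 0 is unique. Hence \<open>x\<close> may be a boundary point of
  \<open>S\<close>.\<close>

lemma has_derivative_affine_on_segment:
  fixes f :: "'a::real_normed_vector \<Rightarrow> real"
  assumes D: "(f has_derivative D) (at x within S)" and S: "closed_segment x y \<subseteq> S"
    and aff: "\<And>t. 0 \<le> t \<Longrightarrow> t \<le> 1 \<Longrightarrow> f (x + t *\<^sub>R (y - x)) = f x + t * c"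
  shows "D (y - x) = c"
proof -
  define g where "g = (\<lambda>t. x + t *\<^sub>R (y - x))"
  have g: "(g has_derivative (\<lambda>t. t *\<^sub>R (y - x))) (at 0 within {0..1})"
    unfolding g_def by (auto intro!: derivative_eq_intros)
  have "g ` {0..1} \<subseteq> S"
    by (force simp: g_def in_segment algebra_simps intro!: subsetD[OF S])
  then have "(f has_derivative D) (at (g 0) within g ` {0..1})"
    using D has_derivative_subset by (auto simp: g_def)
  from has_derivative_in_compose[OF g this]
  have *: "((\<lambda>t. f (g t)) has_derivative (\<lambda>t. D (t *\<^sub>R (y - x)))) (at 0 within {0..1})" .
  have "((\<lambda>t. f (g t)) has_vector_derivative D (y - x)) (at 0 within cbox 0 1)"
    using * linear_scale[OF has_derivative_linear[OF D]] by (simp add: has_vector_derivative_def)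
  moreover have "((\<lambda>t. f x + t * c) has_vector_derivative c) (at 0 within cbox 0 1)"
    by (auto intro!: derivative_eq_intros simp: has_vector_derivative_def)
  then have "((\<lambda>t. f (g t)) has_vector_derivative c) (at 0 within cbox 0 1)"
    by (rule has_vector_derivative_transform[rotated 2]) (use aff in \<open>auto simp: g_def\<close>)
  ultimately show ?thesis
    by (rule vector_derivative_unique_within_closed_interval[rotated 2]) auto
qed

text \<open>Otherwise a nonnegative value forces every cyclically later one to be positive, so the
  \<open>f i\<close> are all positive or all negative, and their weighted mean is not 0.\<close>

lemma sum_eq_0_imp_exists_sign_change:
  fixes f a :: "nat \<Rightarrow> real"
  assumes n: "1 \<le> n" and a: "\<And>i. i \<in> {1..n} \<Longrightarrow> 0 \<le> a i" "sum a {1..n} = 1"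
    and 0: "(\<Sum>i=1..n. a i * f i) = 0"
  shows "\<exists>i\<in>{1..n}. 0 \<le> f i \<and> f (cyc n (int i + 1)) \<le> 0"
proof (rule ccontr)
  assume "\<not> ?thesis"
  then have *: "\<And>i. i \<in> {1..n} \<Longrightarrow> 0 \<le> f i \<Longrightarrow> 0 < f (cyc n (int i + 1))" by force
  obtain k where k: "k \<in> {1..n}" "a k \<noteq> 0"
    using a(2) by (metis sum.neutral zero_neq_one)
  have step: "0 < f (Suc i)" if "0 \<le> f i" "i \<in> {1..<n}" for i
    using *[of i] that by (auto simp: cyc_def nat_add_distrib)
  have wrap: "0 < f 1" if "0 \<le> f n" using *[of n] that n by (auto simp: cyc_def)
  have up: "0 < f j" if "0 \<le> f i" "i \<in> {1..n}" "i < j" "j \<le> n" for i j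
    using that(3,4)
  proof (induction j)
    case (Suc j)
    have "0 \<le> f j" using Suc that(1) by (cases "i = j") auto
    then show ?case using step[of j] Suc that(2) by auto
  qed simp
  show False
  proof (cases "\<exists>i\<in>{1..n}. 0 \<le> f i")
    case True
    then have "0 \<le> f n" using up by (metis atLeastAtMost_iff less_le_not_le nat_less_le order_refl)
    then have 1: "0 < f 1" by (rule wrap)
    then have pos: "0 < f i" if "i \<in> {1..n}" for i
      using up[of 1 i] that by (cases "i = 1") auto
    have "0 < (\<Sum>i=1..n. a i * f i)"
      by (rule sum_pos2[OF _ k(1)]) (use pos a k in \<open>auto simp: less_le intro!: mult_nonneg_nonneg\<close>)
    then show False using 0 by simp
  next
    case False
    then have neg: "f i < 0" if "i \<in> {1..n}" for i using that by (meson not_less)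
    have "0 < (\<Sum>i=1..n. - (a i * f i))"
      by (rule sum_pos2[OF _ k(1)])
        (use neg a k in \<open>auto simp: mult_le_0_iff mult_less_0_iff less_le\<close>)
    then show False using 0 by (simp add: sum_negf)
  qed
qed

section \<open>Cyclic indices and sums of periodic sequences\<close>

lemma cyc_in: "1 \<le> n \<Longrightarrow> cyc n l \<in> {1..n}"
  using pos_mod_bound[of "int n" "l - 1"] by (auto simp: cyc_def nat_less_iff Suc_le_eq)

lemma cyc_of_nat: "k \<in> {1..n} \<Longrightarrow> cyc n (int k) = k"
  by (auto simp: cyc_def nat_diff_distrib)

lemma cyc_cyc_add: "1 \<le> n \<Longrightarrow> cyc n (int (cyc n m) + l) = cyc n (m + l)"
  by (simp add: cyc_def mod_simps algebra_simps)

lemma cyc_add_period: "cyc n (l + int n) = cyc n l"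
  using mod_add_self2[of "l - 1" "int n"] by (simp add: cyc_def algebra_simps)

lemma next_index_neq: "2 \<le> n \<Longrightarrow> i \<in> {1..n} \<Longrightarrow> cyc n (int i + 1) \<noteq> i"
  by (cases "i = n") (auto simp: cyc_def)

text \<open>Moving the window by one trades its first term for the equal term one period
  later.\<close>

lemma sum_period_shift:
  fixes B :: "int \<Rightarrow> real"
  assumes "\<And>l. B (l + int n) = B l"
  shows "(\<Sum>l=1..n. B (int k + int l)) = (\<Sum>l=1..n. B (int l))"
proof (induction k)
  case (Suc k)
  have "(\<Sum>l=1..n. B (int k + 1 + int l)) - (\<Sum>l=1..n. B (int k + int l))
      = (\<Sum>l=1..n. B (int k + int (Suc l)) - B (int k + int l))"
    by (simp add: sum_subtractf algebra_simps)
  also have "\<dots> = B (int k + int (Suc n)) - B (int k + int 1)"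
    using sum_Suc_diff[of 1 n "\<lambda>l. B (int k + int l)"] by (cases "n = 0") simp_all
  also have "\<dots> = 0" using assms[of "int k + 1"] by (simp add: algebra_simps)
  finally show ?case using Suc by (simp add: algebra_simps)
qed simp

lemma weighted_sum_shift:
  fixes B :: "int \<Rightarrow> real"
  assumes per: "\<And>l. B (l + int n) = B l" and n: "1 \<le> n"
    and 0: "(\<Sum>l=1..n. B (int l)) = 0"
  shows "(\<Sum>l=1..n-1. real l * B (int k + 1 + int l)) - (\<Sum>l=1..n-1. real l * B (int k + int l))
    = n * B (int k)"
proof -
  \<comment> \<open>Summation by parts for any upper limit. At \<open>N = n - 1\<close> the last sum
    runs over a full period and vanishes, and the boundary term is \<open>n * B (int k)\<close> by
    periodicity.\<close>
  have "(\<Sum>l=1..N. real l * B (int k + 1 + int l)) - (\<Sum>l=1..N. real l * B (int k + int l))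
    = Suc N * B (int k + int (Suc N)) - (\<Sum>l=1..Suc N. B (int k + int l))" for N
    by (induction N) (simp_all add: algebra_simps)
  from this[of "n - 1"] show ?thesis
    using n per sum_period_shift[of B n k, OF per] 0 by simp
qed

section \<open>A convex polygon with an interior point\<close>

locale pointed_polygon =
  fixes n :: nat and v :: "nat \<Rightarrow> real^2" and T :: "(real^2) set" and xs :: "real^2"
  assumes polygon: "ccw_convex_polygon n v T" and xs: "xs \<in> interior T"
begin

abbreviation succ :: "nat \<Rightarrow> nat" where "succ i \<equiv> cyc n (int i + 1)"

text \<open>Twice the signed area of the triangle over edge \<open>i\<close> with apex
  \<open>x\<close>: an affine function of \<open>x\<close> that vanishes on the line of the
  edge.\<close>

definition side :: "nat \<Rightarrow> real^2 \<Rightarrow> real"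
  where "side i x = cross2 (v (succ i) - v i) (x - v i)"

lemma n_ge: "1 \<le> n" "2 \<le> n" "3 \<le> n"
  using polygon by (simp_all add: ccw_convex_polygon_def)

lemma succ_in: "succ i \<in> {1..n}"
  by (rule cyc_in[OF n_ge(1)])

lemma succ_neq: "i \<in> {1..n} \<Longrightarrow> succ i \<noteq> i"
  by (rule next_index_neq[OF n_ge(2)])

lemma convex_T: "convex T" and compact_T: "compact T"
  using polygon by (simp_all add: ccw_convex_polygon_def polytope_imp_convex polytope_imp_compact)

lemma v_extreme: "i \<in> {1..n} \<Longrightarrow> v i extreme_point_of T"
  using polygon unfolding ccw_convex_polygon_def by blast

lemma v_in_T: "i \<in> {1..n} \<Longrightarrow> v i \<in> T"
  using v_extreme by (auto simp: extreme_point_of_def)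

lemma xs_in_T: "xs \<in> T"
  using xs interior_subset by auto

lemma v_eq_iff: "i \<in> {1..n} \<Longrightarrow> j \<in> {1..n} \<Longrightarrow> v i = v j \<longleftrightarrow> i = j"
  using polygon unfolding ccw_convex_polygon_def by (meson inj_on_eq_iff)

lemma v_succ_neq: "i \<in> {1..n} \<Longrightarrow> v (succ i) \<noteq> v i"
  using succ_neq succ_in v_eq_iff by simp

lemma T_eq_hull: "T = convex hull (v ` {1..n})"
  using Krein_Milman_Minkowski[OF compact_T convex_T] polygon by (simp add: ccw_convex_polygon_def)

lemma side_nonneg: "i \<in> {1..n} \<Longrightarrow> x \<in> T \<Longrightarrow> 0 \<le> side i x"
  using polygon unfolding ccw_convex_polygon_def side_def by blast

text \<open>A small step from \<open>xs\<close> towards the outside of the edge stays in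
  \<open>T\<close>, where \<open>side i\<close> is nonnegative, yet strictly lowers
  \<open>side i\<close>.\<close>

lemma side_xs_pos:
  assumes i: "i \<in> {1..n}"
  shows "0 < side i xs"
proof -
  obtain e where e: "e > 0" "ball xs e \<subseteq> T" using xs mem_interior by blast
  define d where "d = v (succ i) - v i"
  have d: "d \<noteq> 0" using v_succ_neq[OF i] by (simp add: d_def)
  \<comment> \<open>The edge vector turned clockwise by a right angle; the factor \<open>s\<close>
    below makes the step half the radius of the ball.\<close>
  define r :: "real^2" where "r = vector [d$2, - d$1]"
  have nr: "norm r = norm d" by (simp add: r_def norm_vec_def L2_set_def sum_2)
  define s where "s = e / (2 * norm d)"
  have s: "0 < s" using e d by (simp add: s_def)
  have "xs + s *\<^sub>R r \<in> ball xs e" using e d s by (simp add: dist_norm nr) (simp add: s_def)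
  then have "0 \<le> side i (xs + s *\<^sub>R r)" using e side_nonneg[OF i] by auto
  also have "\<dots> = side i xs - s * (d \<bullet> d)"
    unfolding side_def d_def[symmetric] by (simp add: cross2_def r_def inner_vec_def sum_2 algebra_simps)
  finally show ?thesis using s d by (smt (verit) inner_gt_zero_iff mult_pos_pos)
qed

section \<open>The triangles with apex \<open>xs\<close> dissect the polygon\<close>

lemma area_sub_triangle:
  assumes i: "i \<in> {1..n}"
  shows "area (sub_triangle n v xs i) = side i xs / 2"
  using side_xs_pos[OF i]
  by (simp add: area_def sub_triangle_def content_triangle side_def cross2_def abs_if algebra_simps)

text \<open>Seen from \<open>xs\<close>, the direction of \<open>x\<close> lies in the cone over an edge \<open>i\<close> at which the sign of
  \<open>cross2 (v i - xs) (x - xs)\<close> changes. There is one because \<open>xs\<close> is a convex combination of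
  the vertices, so a convex combination of these numbers vanishes.\<close>

lemma T_subset_triangles:
  assumes x: "x \<in> T"
  shows "\<exists>i\<in>{1..n}. x \<in> sub_triangle n v xs i"
proof -
  define s where "s i = cross2 (v i - xs) (x - xs)" for i
  obtain u where u: "\<And>i. i \<in> {1..n} \<Longrightarrow> 0 \<le> u i" "sum u {1..n} = 1" "(\<Sum>i=1..n. u i *\<^sub>R v i) = xs"
  proof -
    obtain w where w: "\<forall>y\<in>v ` {1..n}. 0 \<le> w y" "sum w (v ` {1..n}) = 1"
      "(\<Sum>y\<in>v ` {1..n}. w y *\<^sub>R y) = xs"
      using xs_in_T unfolding T_eq_hull by (auto simp: convex_hull_finite)
    moreover have "inj_on v {1..n}" using v_eq_iff by (auto simp: inj_on_def)
    ultimately show ?thesis using that[of "\<lambda>i. w (v i)"] by (simp add: sum.reindex o_def)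
  qed
  have "(\<Sum>i=1..n. u i * s i) = cross2 (\<Sum>i=1..n. u i *\<^sub>R (v i - xs)) (x - xs)"
    by (simp only: s_def cross2_sum_left cross2_scaleR_left)
  also have "(\<Sum>i=1..n. u i *\<^sub>R (v i - xs)) = xs - (\<Sum>i=1..n. u i) *\<^sub>R xs"
    by (simp add: scaleR_diff_right sum_subtractf flip: u(3) scaleR_left.sum)
  finally have "(\<Sum>i=1..n. u i * s i) = 0" using u(2) by (simp add: cross2_def)
  then obtain i where i: "i \<in> {1..n}" "0 \<le> s i" "s (succ i) \<le> 0"
    using sum_eq_0_imp_exists_sign_change[of n u s] n_ge u by blast
  define C where "C = side i xs"
  have C: "0 < C" using side_xs_pos i by (simp add: C_def)
  \<comment> \<open>Cramer's rule: the coordinates of \<open>x - xs\<close> in the basis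
    \<open>v i - xs\<close>, \<open>v (succ i) - xs\<close>, whose determinant is
    \<open>C\<close>.\<close>
  define a b where "a = - s (succ i) / C" and "b = s i / C"
  have ab: "0 \<le> a" "0 \<le> b" using i C by (auto simp: a_def b_def divide_le_0_iff)
  have "side i x = C - C * a - C * b" using C
    by (simp add: a_def b_def) (simp add: C_def side_def s_def cross2_def algebra_simps)
  then have "0 \<le> C * (1 - a - b)" using side_nonneg[OF i(1) x] by (simp add: algebra_simps)
  then have ab1: "a + b \<le> 1" using C by (simp add: zero_le_mult_iff)
  have "C *\<^sub>R (x - xs) = (- s (succ i)) *\<^sub>R (v i - xs) + s i *\<^sub>R (v (succ i) - xs)"
    by (simp add: vec_eq_iff forall_2 C_def side_def s_def cross2_def algebra_simps)
  also have "\<dots> = C *\<^sub>R (a *\<^sub>R (v i - xs) + b *\<^sub>R (v (succ i) - xs))"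
    using C by (simp add: a_def b_def scaleR_add_right scaleR_diff_right)
  finally have "x - xs = a *\<^sub>R (v i - xs) + b *\<^sub>R (v (succ i) - xs)" using C by simp
  then have "x = a *\<^sub>R v i + b *\<^sub>R v (succ i) + (1 - a - b) *\<^sub>R xs" by (simp add: algebra_simps)
  then have "x \<in> sub_triangle n v xs i"
    unfolding sub_triangle_def convex_hull_3 using ab ab1
    by (intro CollectI exI[of _ a] exI[of _ b] exI[of _ "1 - a - b"]) auto
  then show ?thesis using i by blast
qed

lemma sub_triangle_subset: "i \<in> {1..n} \<Longrightarrow> sub_triangle n v xs i \<subseteq> T"
  unfolding sub_triangle_def
  using v_in_T succ_in xs_in_T convex_T by (intro hull_minimal) auto

text \<open>On the \<open>i\<close>-th triangle the \<open>i\<close>-th normalized side function \<open>side i x / side i xs\<close> is the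
  smallest one, so two triangles overlap only where their side functions agree, which is a line.\<close>

lemma side_le_on_sub_triangle:
  assumes ij: "i \<in> {1..n}" "j \<in> {1..n}" and x: "x \<in> sub_triangle n v xs i"
  shows "side i x * side j xs \<le> side j x * side i xs"
proof -
  obtain a b c where abc: "0 \<le> a" "0 \<le> b" "0 \<le> c" "a + b + c = 1"
    "x = a *\<^sub>R v i + b *\<^sub>R v (succ i) + c *\<^sub>R xs"
    using x unfolding sub_triangle_def convex_hull_3 by auto
  have aff: "side k x = a * side k (v i) + b * side k (v (succ i)) + c * side k xs" for k
  proof -
    have a: "a = 1 - b - c" using abc by simp
    show ?thesis unfolding abc(5) side_def cross2_def a by (simp add: algebra_simps)
  qed
  \<comment> \<open>\<open>side i\<close> vanishes at both ends of its edge, so only the apex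
    contributes; for \<open>side j\<close> the two ends contribute nonnegative amounts.\<close>
  have "side i x = c * side i xs" unfolding aff by (simp add: side_def cross2_def)
  moreover have "c * side j xs \<le> side j x"
    unfolding aff using abc side_nonneg[OF ij(2)] v_in_T succ_in ij by simp
  ultimately show ?thesis
    using side_xs_pos[OF ij(1)] mult_right_mono[of "c * side j xs" "side j x" "side i xs"]
    by (simp add: mult_ac)
qed

text \<open>Three distinct vertices are never collinear. This will show that two different edges do
  not share a line.\<close>

lemma on_side_line:
  assumes ij: "i \<in> {1..n}" "k \<in> {1..n}" and "side i (v k) = 0"
  shows "k = i \<or> k = succ i"
proof (rule ccontr)
  assume "\<not> ?thesis"
  then have "v i \<noteq> v k" "v (succ i) \<noteq> v k" using v_eq_iff ij succ_in by auto
  then show False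
    using extreme_points_not_collinear[OF v_extreme[OF ij(1)] v_extreme[OF succ_in] v_extreme[OF ij(2)]]
      v_succ_neq[OF ij(1)] assms(3) by (auto simp: side_def)
qed

lemma negligible_sub_triangle_Int:
  assumes ij: "i \<in> {1..n}" "j \<in> {1..n}" "i \<noteq> j"
  shows "negligible (sub_triangle n v xs i \<inter> sub_triangle n v xs j)"
proof -
  define p q where "p = v (succ i) - v i" and "q = v (succ j) - v j"
  \<comment> \<open>Direction of the line through \<open>xs\<close> on which the two normalized side
    functions agree.\<close>
  define e where "e = side j xs *\<^sub>R p - side i xs *\<^sub>R q"
  have aff: "side i x = side i xs + cross2 p (x - xs)" "side j x = side j xs + cross2 q (x - xs)" for x
    by (simp_all add: p_def q_def side_def cross2_def algebra_simps)
  have diff: "side i x * side j xs - side j x * side i xs = cross2 e (x - xs)" for x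
    unfolding aff[of x] by (simp add: e_def cross2_diff_left cross2_scaleR_left algebra_simps)
  have "e \<noteq> 0"
  proof
    \<comment> \<open>The side functions would be proportional, putting edge \<open>j\<close> on the
      line of edge \<open>i\<close>. Then edge \<open>j\<close> is edge \<open>i\<close> traversed
      backwards, so \<open>q = - p\<close>, and \<open>e\<close> is a positive multiple of
      \<open>p\<close> after all.\<close>
    assume e: "e = 0"
    have zero: "side i x = 0" if "side j x = 0" for x
      using diff[of x] that side_xs_pos[OF ij(2)] by (simp add: e cross2_def)
    have "side j (v j) = 0" "side j (v (succ j)) = 0" by (simp_all add: side_def cross2_def)
    then have "side i (v j) = 0" "side i (v (succ j)) = 0" using zero by auto
    then have j: "j = succ i" and "succ j = i \<or> succ j = succ i"
      using on_side_line[OF ij(1) ij(2)] on_side_line[OF ij(1) succ_in, of j] ij(3) by auto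
    then have "succ j = i" using succ_neq[OF ij(2)] by simp
    then have "e = (side j xs + side i xs) *\<^sub>R p"
      using j by (simp add: e_def p_def q_def algebra_simps)
    then show False
      using e side_xs_pos[OF ij(1)] side_xs_pos[OF ij(2)] v_succ_neq[OF ij(1)] by (auto simp: p_def)
  qed
  \<comment> \<open>\<open>e\<close> turned by a right angle, a normal of the line containing the
    overlap.\<close>
  define r :: "real^2" where "r = vector [- e$2, e$1]"
  have "r \<noteq> 0" using \<open>e \<noteq> 0\<close> by (auto simp: r_def vec_eq_iff forall_2)
  have "r \<bullet> x = r \<bullet> xs" if "x \<in> sub_triangle n v xs i \<inter> sub_triangle n v xs j" for x
  proof -
    have "cross2 e (x - xs) = 0"
      using diff[of x] side_le_on_sub_triangle[of i j x] side_le_on_sub_triangle[of j i x] ij that by auto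
    then show ?thesis by (simp add: r_def cross2_def inner_vec_def sum_2 algebra_simps)
  qed
  then show ?thesis
    by (intro negligible_subset[OF negligible_hyperplane[of r "r \<bullet> xs"]]) (use \<open>r \<noteq> 0\<close> in auto)
qed

text \<open>The triangles cover \<open>T\<close> and overlap in null sets. All sets involved are
  compact, hence Borel, so Lebesgue measure gives the same areas.\<close>

lemma area_T: "area T = (\<Sum>i=1..n. area (sub_triangle n v xs i))"
proof -
  have c: "compact (sub_triangle n v xs i)" for i
    by (simp add: sub_triangle_def finite_imp_compact_convex_hull)
  have eq: "area S = measure lebesgue S" if "compact S" for S :: "(real^2) set"
    using that by (simp add: area_def borel_compact)
  have "T = (\<Union>i\<in>{1..n}. sub_triangle n v xs i)"
    using T_subset_triangles sub_triangle_subset by blast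
  moreover have "measure lebesgue (\<Union>i\<in>{1..n}. sub_triangle n v xs i)
      = (\<Sum>i=1..n. measure lebesgue (sub_triangle n v xs i))"
    using negligible_sub_triangle_Int c lmeasurable_compact
    by (intro measure_negligible_finite_Union_image) (auto simp: pairwise_def)
  ultimately have "measure lebesgue T = (\<Sum>i=1..n. measure lebesgue (sub_triangle n v xs i))"
    by simp
  then show ?thesis using eq c compact_T by simp
qed

lemma area_T_pos: "0 < area T"
  unfolding area_T using n_ge by (intro sum_pos) (auto simp: area_sub_triangle side_xs_pos)

section \<open>Normal components of fields on the edges\<close>

lemma normal_eq:
  assumes j: "j \<in> {1..n}" and \<nu>: "outward_unit_normal T (v j) (v (succ j)) \<nu>"
  shows "edge_length n v j *\<^sub>R \<nu> = vector [(v (succ j) - v j)$2, - ((v (succ j) - v j)$1)]"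
proof -
  define d where "d = v (succ j) - v j"
  define L where "L = edge_length n v j"
  define r :: "real^2" where "r = vector [d$2, - d$1]"
  define s where "s = \<nu> \<bullet> r"
  have L: "L = norm d" "0 < L"
    using v_succ_neq[OF j] by (auto simp: L_def d_def edge_length_def dist_norm norm_minus_commute)
  have r: "norm r = L" by (simp add: L r_def norm_vec_def L2_set_def sum_2)
  have orth: "\<nu>$1 * d$1 + \<nu>$2 * d$2 = 0"
    using \<nu> by (simp add: outward_unit_normal_def d_def inner_vec_def sum_2)
  have s: "s = \<nu>$1 * d$2 - \<nu>$2 * d$1" by (simp add: s_def r_def inner_vec_def sum_2)
  have L2: "L\<^sup>2 = d$1 * d$1 + d$2 * d$2"
    by (simp add: L(1) power2_norm_eq_inner inner_vec_def sum_2)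
  \<comment> \<open>Expansion of the normal in the orthogonal basis \<open>d\<close>,
    \<open>r\<close>, in which its \<open>d\<close> component is 0.\<close>
  have "L\<^sup>2 * \<nu>$1 - s * d$2 = d$1 * (\<nu>$1 * d$1 + \<nu>$2 * d$2)"
    "L\<^sup>2 * \<nu>$2 + s * d$1 = d$2 * (\<nu>$1 * d$1 + \<nu>$2 * d$2)"
    unfolding L2 s by (simp_all add: algebra_simps)
  then have "L\<^sup>2 * \<nu>$1 = s * d$2" "L\<^sup>2 * \<nu>$2 = - (s * d$1)"
    unfolding orth by simp_all
  then have eq: "L\<^sup>2 *\<^sub>R \<nu> = s *\<^sub>R r" by (simp add: vec_eq_iff forall_2 r_def)
  have "norm (L\<^sup>2 *\<^sub>R \<nu>) = norm (s *\<^sub>R r)" using eq by simp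
  then have "L\<^sup>2 = \<bar>s\<bar> * L" using \<nu> r by (simp add: outward_unit_normal_def)
  then have abs_s: "\<bar>s\<bar> = L" using L by (simp add: power2_eq_square)
  \<comment> \<open>The norm fixes \<open>s\<close> up to sign; the interior point
    \<open>xs\<close>, strictly left of the edge, decides the sign.\<close>
  have "\<nu> \<bullet> (xs - v j) \<le> 0" using \<nu> xs_in_T by (simp add: outward_unit_normal_def)
  then have "(L\<^sup>2 *\<^sub>R \<nu>) \<bullet> (xs - v j) \<le> 0" by (simp add: mult_le_0_iff)
  also have "(L\<^sup>2 *\<^sub>R \<nu>) \<bullet> (xs - v j) = - (s * side j xs)"
    unfolding eq side_def d_def[symmetric]
    by (simp add: r_def cross2_def inner_vec_def sum_2 algebra_simps)
  finally have "0 \<le> s" using side_xs_pos[OF j] by (simp add: zero_le_mult_iff)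
  then have "L *\<^sub>R (L *\<^sub>R \<nu>) = L *\<^sub>R r" using eq abs_s by (simp add: power2_eq_square)
  then have "L *\<^sub>R \<nu> = r" using L(2) by (intro scaleR_left_imp_eq[of L "L *\<^sub>R \<nu>" r]) simp_all
  then show ?thesis by (simp add: L_def r_def d_def)
qed

lemma edge_length_pos: "j \<in> {1..n} \<Longrightarrow> 0 < edge_length n v j"
  using v_succ_neq[of j] by (simp add: edge_length_def dist_commute)

lemma edge_subset: "j \<in> {1..n} \<Longrightarrow> edge n v j \<subseteq> T"
  unfolding edge_def using v_in_T succ_in convex_T by (simp add: closed_segment_subset)

text \<open>The normal component is the distance from \<open>xs\<close> to the line of the edge, the
  same for every \<open>x\<close> on it.\<close>

lemma position_field_normal:
  assumes j: "j \<in> {1..n}" and \<nu>: "outward_unit_normal T (v j) (v (succ j)) \<nu>"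
    and x: "x \<in> edge n v j"
  shows "edge_length n v j * (position_field T xs x \<bullet> \<nu>) = side j xs"
proof -
  define d where "d = v (succ j) - v j"
  have xT: "x \<in> T" using x edge_subset[OF j] by auto
  obtain u where u: "x = v j + u *\<^sub>R d"
    using x by (auto simp: edge_def in_segment d_def algebra_simps)
  have "edge_length n v j * (position_field T xs x \<bullet> \<nu>) = (x - xs) \<bullet> (edge_length n v j *\<^sub>R \<nu>)"
    using xT by (simp add: position_field_def field_on_def)
  also have "\<dots> = side j xs"
    unfolding normal_eq[OF j \<nu>] side_def d_def[symmetric] u
    by (simp add: cross2_def inner_vec_def sum_2 algebra_simps)
  finally show ?thesis .
qed

text \<open>The curl is the gradient turned counterclockwise by a right angle, the normal is the
  edge direction turned clockwise; together the turns produce the minus sign.\<close>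

lemma curl_normal:
  assumes j: "j \<in> {1..n}" and \<nu>: "outward_unit_normal T (v j) (v (succ j)) \<nu>"
    and x: "x \<in> T" and f: "f differentiable (at x within T)"
  shows "edge_length n v j * (curl T f x \<bullet> \<nu>)
    = - frechet_derivative f (at x within T) (v (succ j) - v j)"
proof -
  define d where "d = v (succ j) - v j"
  define D where "D = frechet_derivative f (at x within T)"
  have lin: "linear D" using f unfolding D_def by (rule linear_frechet_derivative)
  have "d = d$1 *\<^sub>R axis 1 1 + d$2 *\<^sub>R axis 2 1" by (simp add: vec_eq_iff forall_2 axis_def)
  then have "D d = D (d$1 *\<^sub>R axis 1 1 + d$2 *\<^sub>R axis 2 1)" by (rule arg_cong)
  also have "\<dots> = d$1 * D (axis 1 1) + d$2 * D (axis 2 1)"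
    by (simp add: linear_add[OF lin] linear_scale[OF lin])
  finally have D: "D d = d$1 * D (axis 1 1) + d$2 * D (axis 2 1)" .
  have "edge_length n v j * (curl T f x \<bullet> \<nu>) = curl T f x \<bullet> (edge_length n v j *\<^sub>R \<nu>)" by simp
  also have "\<dots> = - D d"
    unfolding normal_eq[OF j \<nu>] D using x
    by (simp add: curl_def field_on_def partial_within_def D_def d_def inner_vec_def sum_2 algebra_simps)
  finally show ?thesis by (simp add: D_def d_def)
qed

text \<open>Uniqueness of the derivative within \<open>T\<close>, also at boundary points, where the library criterion
  in terms of the coordinate directions does not apply.\<close>

lemma linear_eq_0_if_vanishes_on_T:
  fixes D :: "real^2 \<Rightarrow> real"
  assumes "linear D" and 0: "\<And>y. y \<in> T \<Longrightarrow> D (y - x) = 0"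
  shows "D = (\<lambda>_. 0)"
proof
  fix y :: "real^2"
  obtain e where e: "e > 0" "ball xs e \<subseteq> T" using xs mem_interior by blast
  define s where "s = e / (norm y + 1)"
  have ny: "0 < norm y + 1" by (simp add: add_nonneg_pos)
  then have s: "0 < s" using e by (simp add: s_def)
  have "s * norm y < e" using e ny by (simp add: s_def pos_divide_less_eq)
  then have "xs + s *\<^sub>R y \<in> T" using e s by (auto simp: dist_norm intro!: subsetD[OF e(2)])
  \<comment> \<open>A small multiple of any \<open>y\<close> is a difference of two vectors leading
    from \<open>x\<close> into \<open>T\<close>.\<close>
  then have "D ((xs + s *\<^sub>R y - x) - (xs - x)) = 0"
    unfolding linear_diff[OF assms(1), of _ "xs - x"] using 0 xs_in_T by simp
  then show "D y = 0" using s linear_scale[OF assms(1)] by simp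
qed

end

lemma sum_fun_apply: "(\<Sum>i\<in>A. f i) x = (\<Sum>i\<in>A. f i x)"
  by (induction A rule: infinite_finite_induct) auto

section \<open>Barycentric coordinates and the duality with the edge normals\<close>

locale barycentric_polygon = pointed_polygon n v T xs
  for n :: nat and v :: "nat \<Rightarrow> real^2" and T :: "(real^2) set" and xs :: "real^2" +
  fixes \<nu> :: "nat \<Rightarrow> real^2" and lam :: "nat \<Rightarrow> real^2 \<Rightarrow> real"
  assumes normals: "\<And>j. j \<in> {1..n} \<Longrightarrow> outward_unit_normal T (v j) (v (succ j)) (\<nu> j)"
    and gbc: "generalized_barycentric n v T lam"
    and lam_vertex: "\<And>i j. i \<in> {1..n} \<Longrightarrow> j \<in> {1..n} \<Longrightarrow> lam i (v j) = (if i = j then 1 else 0)"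
    and lam_edge: "\<And>i j. i \<in> {1..n} \<Longrightarrow> j \<in> {1..n} \<Longrightarrow>
        \<exists>L. affine_function L \<and> (\<forall>x\<in>edge n v j. lam i x = L x)"
    and lam_C1: "\<And>i. i \<in> {1..n} \<Longrightarrow> C1_on T (lam i)"
begin

lemma lam_differentiable: "k \<in> {1..n} \<Longrightarrow> x \<in> T \<Longrightarrow> lam k differentiable (at x within T)"
  using lam_C1 by (simp add: C1_on_def differentiable_on_def)

text \<open>Along the edge \<open>lam k\<close> is affine with prescribed end values, so its
  derivative in the edge direction is their difference.\<close>

lemma curl_lam_normal:
  assumes j: "j \<in> {1..n}" and k: "k \<in> {1..n}" and x: "x \<in> edge n v j"
  shows "edge_length n v j * (curl T (lam k) x \<bullet> \<nu> j) = of_bool (k = j) - of_bool (k = succ j)"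
proof -
  have xT: "x \<in> T" using x edge_subset[OF j] by auto
  define D where "D = frechet_derivative (lam k) (at x within T)"
  have D: "(lam k has_derivative D) (at x within T)"
    using lam_differentiable[OF k xT] by (simp add: D_def frechet_derivative_works)
  obtain L where L: "affine_function L" "\<And>x. x \<in> edge n v j \<Longrightarrow> lam k x = L x"
    using lam_edge[OF k j] by blast
  obtain f c where f: "linear f" "L = (\<lambda>x. f x + c)" using L(1) by (auto simp: affine_function_def)
  have ends: "v j \<in> edge n v j" "v (succ j) \<in> edge n v j" by (auto simp: edge_def)
  have along: "D (y - x) = L y - L x" if y: "y \<in> edge n v j" for y
  proof (rule has_derivative_affine_on_segment[OF D])
    have seg: "closed_segment x y \<subseteq> edge n v j"
      using x y unfolding edge_def by (rule subset_closed_segment[THEN iffD2, OF conjI])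
    then show "closed_segment x y \<subseteq> T" using edge_subset[OF j] by blast
    fix t :: real assume "0 \<le> t" "t \<le> 1"
    then have "x + t *\<^sub>R (y - x) \<in> closed_segment x y" by (force simp: in_segment algebra_simps)
    then have "lam k (x + t *\<^sub>R (y - x)) = L (x + t *\<^sub>R (y - x))" using seg L by blast
    also have "\<dots> = L x + t * (L y - L x)"
      by (simp add: f linear_add linear_diff linear_scale)
    finally show "lam k (x + t *\<^sub>R (y - x)) = lam k x + t * (L y - L x)" using L(2)[OF x] by simp
  qed
  \<comment> \<open>Only directions from \<open>x\<close> to points of the edge are covered by
    \<open>along\<close>, so the edge vector is split at \<open>x\<close>.\<close>
  have "D (v (succ j) - v j) = D ((v (succ j) - x) - (v j - x))" by simp
  also have "\<dots> = D (v (succ j) - x) - D (v j - x)"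
    by (rule linear_diff[OF has_derivative_linear[OF D]])
  also have "\<dots> = L (v (succ j)) - L (v j)" by (simp add: along ends)
  also have "\<dots> = of_bool (k = succ j) - of_bool (k = j)"
    using L(2)[OF ends(1)] L(2)[OF ends(2)] lam_vertex[OF k j] lam_vertex[OF k succ_in[of j]] by auto
  finally show ?thesis
    using curl_normal[OF j normals[OF j] xT lam_differentiable[OF k xT]] by (simp add: D_def)
qed

lemma sum_b_coeff: "(\<Sum>l=1..n. b_coeff n v T xs i (int l)) = 0" if i: "i \<in> {1..n}"
proof -
  have "(\<Sum>l=1..n. b_coeff n v T xs i (int l)) = (\<Sum>l=1..n. (if i = l then edge_length n v l else 0)
      - edge_length n v i / area T * area (sub_triangle n v xs l))"
    by (intro sum.cong) (auto simp: b_coeff_def Let_def cyc_of_nat)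
  also have "\<dots> = edge_length n v i - edge_length n v i / area T * area T"
    using i unfolding sum_subtractf sum_distrib_left[symmetric] area_T by simp
  finally show ?thesis using area_T_pos by simp
qed

lemma c_coeff_diff:
  assumes i: "i \<in> {1..n}" and j: "j \<in> {1..n}"
  shows "c_coeff n v T xs i j - c_coeff n v T xs i (succ j) = b_coeff n v T xs i (int j)"
proof -
  define B where "B = b_coeff n v T xs i"
  have per: "B (l + int n) = B l" for l by (simp add: B_def b_coeff_def cyc_add_period)
  \<comment> \<open>At \<open>j = n\<close> the successor is 1 instead of \<open>n + 1\<close>;
    periodicity of \<open>B\<close> absorbs this.\<close>
  have B_cyc: "B (int (succ j) + l) = B (int j + 1 + l)" for l
    by (simp add: B_def b_coeff_def cyc_cyc_add[OF n_ge(1)])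
  \<comment> \<open>Index 0 is reserved for the coefficient of the position field.\<close>
  have "succ j \<noteq> 0" "j \<noteq> 0" using succ_in[of j] j by auto
  then have "c_coeff n v T xs i j - c_coeff n v T xs i (succ j)
     = 1 / n * ((\<Sum>l=1..n-1. real l * B (int j + 1 + int l)) - (\<Sum>l=1..n-1. real l * B (int j + int l)))"
    unfolding c_coeff_def B_def[symmetric] B_cyc by (simp add: right_diff_distrib)
  also have "\<dots> = B (int j)"
    using weighted_sum_shift[of B n j, OF per] n_ge sum_b_coeff[OF i] by (simp add: B_def)
  finally show ?thesis by (simp add: B_def)
qed

abbreviation q where "q i \<equiv> q_field n v T xs lam i"

lemma q_apply:
  "q i x = c_coeff n v T xs i 0 *\<^sub>R position_field T xs x
    + (\<Sum>k=1..n. c_coeff n v T xs i k *\<^sub>R curl T (lam k) x)"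
  by (simp add: q_field_def field_scale_def sum_fun_apply)

lemma q_normal:
  assumes i: "i \<in> {1..n}" and j: "j \<in> {1..n}" and x: "x \<in> edge n v j"
  shows "q i x \<bullet> \<nu> j = (if i = j then 1 else 0)"
proof -
  define c where "c = c_coeff n v T xs i"
  define L where "L = edge_length n v j"
  have L: "0 < L" using edge_length_pos[OF j] by (simp add: L_def)
  have "L * (q i x \<bullet> \<nu> j) = c 0 * (L * (position_field T xs x \<bullet> \<nu> j))
      + (\<Sum>k=1..n. c k * (L * (curl T (lam k) x \<bullet> \<nu> j)))"
    by (simp add: q_apply c_def inner_add_left inner_sum_left distrib_left sum_distrib_left mult_ac)
  also have "L * (position_field T xs x \<bullet> \<nu> j) = 2 * area (sub_triangle n v xs j)"
    using position_field_normal[OF j normals[OF j] x] area_sub_triangle[OF j] by (simp add: L_def)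
  also have "(\<Sum>k=1..n. c k * (L * (curl T (lam k) x \<bullet> \<nu> j)))
      = (\<Sum>k=1..n. c k * (of_bool (k = j) - of_bool (k = succ j)))"
    by (intro sum.cong) (simp_all add: L_def curl_lam_normal[OF j _ x])
  also have "\<dots> = c j - c (succ j)"
    using j succ_in[of j] by (simp add: right_diff_distrib sum_subtractf of_bool_def if_distrib[of "\<lambda>t. _ * t"] cong: if_cong)
  also have "\<dots> = b_coeff n v T xs i (int j)" unfolding c_def by (rule c_coeff_diff[OF i j])
  also have "\<dots> = (if i = j then L else 0)
      - edge_length n v i * (area (sub_triangle n v xs j) / area T)"
    using j by (simp add: b_coeff_def Let_def cyc_of_nat L_def)
  \<comment> \<open>With this value the position term
    \<open>c 0 * (2 * area (sub_triangle n v xs j))\<close> cancels the area term of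
    \<open>b_coeff\<close>.\<close>
  also have "c 0 = edge_length n v i / (2 * area T)" by (simp add: c_def c_coeff_def)
  finally have "L * (q i x \<bullet> \<nu> j) = (if i = j then L else 0)" by simp
  then show ?thesis using L by (auto split: if_splits)
qed

section \<open>The fields \<open>q i\<close> form a basis\<close>

lemma chi_eq_span: "chi n T xs lam = fields.span (insert (position_field T xs) ((\<lambda>i. curl T (lam i)) ` {1..n}))"
proof -
  have eq: "{curl T (lam i) |i. i \<in> {1..n}} = (\<lambda>i. curl T (lam i)) ` {1..n}" by auto
  have "chi n T xs lam = fields.span ((\<lambda>i. curl T (lam i)) ` {1..n} \<union> {position_field T xs})"
    unfolding chi_def fields.span_Un eq by blast
  then show ?thesis by simp
qed

lemma q_in_chi: "q i \<in> chi n T xs lam"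
  unfolding chi_eq_span q_field_def
  by (intro fields.span_add fields.span_sum fields.span_scale fields.span_base) auto

text \<open>Reproduction of the constant 1 makes the \<open>lam k\<close> sum to 1 on
  \<open>T\<close>, so the derivative of the sum within \<open>T\<close> is 0, also at boundary
  points.\<close>

lemma sum_curl_lam: "(\<Sum>k=1..n. curl T (lam k)) = 0"
proof
  fix x
  show "(\<Sum>k=1..n. curl T (lam k)) x = 0 x"
  proof (cases "x \<in> T")
    case True
    define D where "D k = frechet_derivative (lam k) (at x within T)" for k
    have D: "(lam k has_derivative D k) (at x within T)" if "k \<in> {1..n}" for k
      using lam_differentiable[OF that True] by (simp add: D_def frechet_derivative_works)
    define E where "E = (\<lambda>h. \<Sum>k=1..n. D k h)"
    have E: "((\<lambda>y. \<Sum>k=1..n. lam k y) has_derivative E) (at x within T)"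
      unfolding E_def using D by (intro has_derivative_sum)
    have "affine_function (\<lambda>x. 1)"
      unfolding affine_function_def using linear_zero by (intro exI[of _ "\<lambda>x. 0"] exI[of _ 1]) auto
    then have one: "(\<Sum>k=1..n. lam k y) = 1" if "y \<in> T" for y
      using gbc that unfolding generalized_barycentric_def by fastforce
    have "E (y - x) = 0" if y: "y \<in> T" for y
    proof (rule has_derivative_affine_on_segment[OF E])
      show seg: "closed_segment x y \<subseteq> T" using convex_T True y by (simp add: closed_segment_subset)
      fix t :: real assume "0 \<le> t" "t \<le> 1"
      then have "x + t *\<^sub>R (y - x) \<in> closed_segment x y" by (force simp: in_segment algebra_simps)
      then show "(\<Sum>k=1..n. lam k (x + t *\<^sub>R (y - x))) = (\<Sum>k=1..n. lam k x) + t * 0"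
        using one True seg by auto
    qed
    then have "E = (\<lambda>_. 0)"
      using linear_eq_0_if_vanishes_on_T[OF has_derivative_linear[OF E]] by blast
    then have "(\<Sum>k=1..n. partial_within m T (lam k) x) = 0" for m
      by (simp add: partial_within_def E_def D_def fun_eq_iff)
    then show ?thesis using True
      by (simp add: sum_fun_apply curl_def field_on_def vec_eq_iff forall_2 sum_negf)
  qed (simp add: sum_fun_apply curl_def field_on_def)
qed

text \<open>The last curl is minus the sum of the others. What remains is a spanning family of at
  most \<open>n\<close> fields.\<close>

lemma chi_subset_span:
  "chi n T xs lam \<subseteq> fields.span (insert (position_field T xs) ((\<lambda>i. curl T (lam i)) ` {1..<n}))"
    (is "_ \<subseteq> fields.span ?P")
proof -
  have lt: "curl T (lam k) \<in> fields.span ?P" if "k \<in> {1..<n}" for k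
    using that by (intro fields.span_base) auto
  have "{1..n} = insert n {1..<n}" using n_ge by auto
  then have "curl T (lam n) = - (\<Sum>k\<in>{1..<n}. curl T (lam k))"
    using sum_curl_lam by (simp add: eq_neg_iff_add_eq_0)
  then have "curl T (lam n) \<in> fields.span ?P"
    using lt by (simp only:) (intro fields.span_neg fields.span_sum)
  then have "curl T (lam k) \<in> fields.span ?P" if "k \<in> {1..n}" for k
    using lt that by (cases "k = n") auto
  then show ?thesis
    unfolding chi_eq_span by (intro fields.span_minimal fields.subspace_span) (auto intro: fields.span_base)
qed

text \<open>One test point per edge: the functional sending \<open>F\<close> to
  \<open>F (v j) \<bullet> \<nu> j\<close> is the one dual to \<open>q j\<close>.\<close>

lemma v_in_edge: "v j \<in> edge n v j"
  by (simp add: edge_def)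

text \<open>Independence of the image set alone would not exclude repeated fields; injectivity also
  gives the set its \<open>n\<close> elements.\<close>

lemma inj_q: "inj_on q {1..n}"
proof (rule inj_onI)
  fix i j assume i: "i \<in> {1..n}" and j: "j \<in> {1..n}" and eq: "q i = q j"
  have "(if j = i then 1 else 0) = q i (v i) \<bullet> \<nu> i"
    unfolding eq by (rule q_normal[OF j i v_in_edge, symmetric])
  also have "\<dots> = 1" by (simp add: q_normal[OF i i v_in_edge])
  finally show "i = j" by (simp split: if_splits)
qed

text \<open>Pairing a vanishing combination with the \<open>j\<close>-th dual functional isolates
  its \<open>j\<close>-th coefficient.\<close>

lemma independent_q: "fields.independent (q ` {1..n})"
proof -
  have "u (q j) = 0" if u: "(\<Sum>F\<in>q ` {1..n}. field_scale (u F) F) = 0" and j: "j \<in> {1..n}" for u j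
  proof -
    have "(\<Sum>i=1..n. field_scale (u (q i)) (q i)) = 0"
      using u inj_q by (simp add: sum.reindex)
    then have "(\<Sum>i=1..n. field_scale (u (q i)) (q i)) (v j) \<bullet> \<nu> j = 0" by simp
    then have "(\<Sum>i=1..n. u (q i) * (q i (v j) \<bullet> \<nu> j)) = 0"
      by (simp add: sum_fun_apply field_scale_def inner_sum_left)
    moreover have "(\<Sum>i=1..n. u (q i) * (q i (v j) \<bullet> \<nu> j)) = (\<Sum>i=1..n. if i = j then u (q i) else 0)"
      using q_normal[OF _ j v_in_edge] by (intro sum.cong) auto
    ultimately show ?thesis using j by simp
  qed
  then show ?thesis by (auto simp: fields.dependent_finite)
qed

text \<open>Dimension count: a field outside the span would give \<open>n + 1\<close> independent
  fields in a space spanned by at most \<open>n\<close>.\<close>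

lemma span_q: "fields.span (q ` {1..n}) = chi n T xs lam"
proof
  show "fields.span (q ` {1..n}) \<subseteq> chi n T xs lam"
    unfolding chi_eq_span
    by (intro fields.span_minimal fields.subspace_span) (use q_in_chi chi_eq_span in auto)
  show "chi n T xs lam \<subseteq> fields.span (q ` {1..n})"
  proof
    fix F assume F: "F \<in> chi n T xs lam"
    let ?P = "insert (position_field T xs) ((\<lambda>i. curl T (lam i)) ` {1..<n})"
    show "F \<in> fields.span (q ` {1..n})"
    proof (rule ccontr)
      assume not: "F \<notin> fields.span (q ` {1..n})"
      then have "fields.independent (insert F (q ` {1..n}))"
        using independent_q fields.independent_insertI by blast
      moreover have "insert F (q ` {1..n}) \<subseteq> fields.span ?P"
        using F q_in_chi chi_subset_span by blast
      ultimately have "card (insert F (q ` {1..n})) \<le> card ?P"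
        using fields.independent_span_bound[of ?P] by blast
      also have "\<dots> \<le> n"
        using card_insert_le_m1[of n "(\<lambda>i. curl T (lam i)) ` {1..<n}" "position_field T xs"]
          card_image_le[of "{1..<n}" "\<lambda>i. curl T (lam i)"] n_ge by simp
      finally show False
        using not fields.span_base[of F "q ` {1..n}"] card_image[OF inj_q] by (simp add: card_insert_if split: if_splits)
    qed
  qed
qed

end

theorem lemma3p1:
  fixes n :: nat and T :: "(real^2) set" and v \<nu> :: "nat \<Rightarrow> real^2" and xs :: "real^2"
    and lam :: "nat \<Rightarrow> real^2 \<Rightarrow> real"
  assumes polygon: "ccw_convex_polygon n v T"
    and normals: "\<And>j. j \<in> {1..n} \<Longrightarrow> outward_unit_normal T (v j) (next_vertex n v j) (\<nu> j)"
    and xs: "xs \<in> interior T"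
    and gbc: "generalized_barycentric n v T lam"
    and lam_vertex: "\<And>i j. i \<in> {1..n} \<Longrightarrow> j \<in> {1..n} \<Longrightarrow> lam i (v j) = (if i = j then 1 else 0)"
    and lam_edge: "\<And>i j. i \<in> {1..n} \<Longrightarrow> j \<in> {1..n} \<Longrightarrow>
        \<exists>L. affine_function L \<and> (\<forall>x\<in>edge n v j. lam i x = L x)"
    and lam_C1: "\<And>i. i \<in> {1..n} \<Longrightarrow> C1_on T (lam i)"
  shows "(\<forall>i\<in>{1..n}. q_field n v T xs lam i \<in> chi n T xs lam) \<and>
    (\<forall>i\<in>{1..n}. \<forall>j\<in>{1..n}. \<forall>x\<in>edge n v j.
        q_field n v T xs lam i x \<bullet> \<nu> j = (if i = j then 1 else 0)) \<and>
    inj_on (q_field n v T xs lam) {1..n} \<and>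
    fields.independent (q_field n v T xs lam ` {1..n}) \<and>
    fields.span (q_field n v T xs lam ` {1..n}) = chi n T xs lam"
proof -
  interpret barycentric_polygon n v T xs \<nu> lam
    by unfold_locales (fact assms)+
  show ?thesis using q_in_chi q_normal inj_q independent_q span_q by blast
qed

end
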